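(* Let $\mathcal{W}^{\nu,\mu}_\tau$ be the transformation $[\mathcal{W}^{\nu,\mu}_\tau f](z):=e^{i\varphi^{\nu,\mu}_\tau(z)}f(z)$. Then the image under $\mathcal{W}^{\nu,\mu}_\tau$ of the space $\mathcal{M}^{\nu,\mu}_\tau(\mathbb{C})$ of mixed $\Gamma$-automorphic forms of type $(\nu,\mu)$ is the space of Landau $(\Gamma,\chi_\tau)$-automorphic functions of magnitude $B^{\nu,\mu}_\tau=\nu+\mu\big(|\frac{\partial\tau}{\partial z}|^2-|\frac{\partial\tau}{\partial\bar z}|^2\big)$ with multiplier $$\chi_\tau(\gamma)=\exp\big(i\varphi^{\nu,\mu}_\tau(\gamma)-2i\mu\,\Im\langle\tau(0),\rho(\gamma)^{-1}\cdot 0\rangle\big),\qquad \gamma\in\Gamma.$$ That is, $$\mathcal{W}^{\nu,\mu}_\tau\big(\mathcal{M}^{\nu,\mu}_\tau(\mathbb{C})\big)=\Big\{F:\mathbb{C}\to\mathbb{C}\ \text{of class}\ \mathcal{C}^\infty:\ F(z+\gamma)=\chi_\tau(\gamma)\,j^{-B^{\nu,\mu}_\tau}(\gamma,z)\,F(z)\ \text{for all } z\in\mathbb{C},\ \gamma\in\Gamma\Big\}.$$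
   Context: Let $\mathbf{T}=\{\lambda\in\mathbb{C}:|\lambda|=1\}$ and $G=\mathbf{T}\rtimes\mathbb{C}$ be the group of matrices $[a,b]:=\begin{pmatrix}a&b\\0&1\end{pmatrix}$, $a\in\mathbf{T}$, $b\in\mathbb{C}$, acting on $\mathbb{C}$ by $g\cdot z=az+b$ for $g=[a,b]$. Write $\langle z,w\rangle=z\bar w$. For $\alpha\in\mathbb{R}$, set $j^\alpha(g,z)=e^{2i\alpha\,\Im\langle z,g^{-1}\cdot 0\rangle}$, $g\in G$, $z\in\mathbb{C}$. Let $\Gamma$ be a uniform lattice in $\mathbb{C}$ (discrete cocompact additive subgroup), with $\gamma\in\Gamma$ identified with $[1,\gamma]\in G$, so $\gamma\cdot z=z+\gamma$. Let $(\rho,\tau)$ be an equivariant pair: $\rho:G\to G$ is a group endomorphism and $\tau:\mathbb{C}\to\mathbb{C}$ is a smooth map with $\tau(g\cdot z)=\rho(g)\cdot\tau(z)$ for all $g\in G$, $z\in\mathbb{C}$. Let $\nu,\mu>0$ be real numbers. The space $\mathcal{M}^{\nu,\mu}_\tau(\mathbb{C})$ of mixed $\Gamma$-automorphic forms of type $(\nu,\mu)$ with respect to $(\rho,\tau)$ is the space of all $\mathcal{C}^\infty$ functions $F:\mathbb{C}\to\mathbb{C}$ with $F(z+\gamma)=j^{-\nu}(\gamma,z)\,j^{-\mu}(\rho(\gamma),\tau(z))\,F(z)$ for all $\gamma\in\Gamma$, $z\in\mathbb{C}$. The function $B^{\nu,\mu}_\tau=\nu+\mu\big(|\frac{\partial\tau}{\partial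 z}|^2-|\frac{\partial\tau}{\partial\bar z}|^2\big)$ is a real constant on $\mathbb{C}$. Set $S^{\nu,\mu}_\tau(z)=\nu z+\mu\big(\tau\frac{\partial\bar\tau}{\partial\bar z}-\bar\tau\frac{\partial\tau}{\partial\bar z}\big)$. The function $\varphi^{\nu,\mu}_\tau:\mathbb{C}\to\mathbb{R}$ is the (unique) real-valued smooth function with $\varphi^{\nu,\mu}_\tau(0)=0$ and $\frac{\partial\varphi^{\nu,\mu}_\tau}{\partial\bar z}=-i\big(S^{\nu,\mu}_\tau-B^{\nu,\mu}_\tau z\big)$. *)

theory Defs
  imports "HOL-Analysis.Analysis" "HOL-Algebra.Group"
begin

section \<open>The motion group of the complex plane\<close>

text \<open>
  The pair \<open>(a, b)\<close> encodes the matrix \<open>[a,b]\<close> with rows \<open>(a, b)\<close> and \<open>(0, 1)\<close>; see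
  \<open>affine_matrix_mult\<close> below.
\<close>

definition motion_group :: "(complex \<times> complex) monoid" where
  "motion_group =
     \<lparr>carrier = {(a, b). cmod a = 1},
      monoid.mult = (\<lambda>(a, b) (c, d). (a * c, a * d + b)),
      one = (1, 0)\<rparr>"

definition act :: "complex \<times> complex \<Rightarrow> complex \<Rightarrow> complex" where
  "act g z = fst g * z + snd g"

definition translation :: "complex \<Rightarrow> complex \<times> complex" where
  "translation \<gamma> = (1, \<gamma>)"

definition affine_matrix :: "complex \<times> complex \<Rightarrow> complex ^ 2 ^ 2" where
  "affine_matrix g = vector [vector [fst g, snd g], vector [0, 1]]"

lemma affine_matrix_mult:
  "affine_matrix (g \<otimes>\<^bsub>motion_group\<^esub> h) = affine_matrix g ** affine_matrix h"
  by (simp add: affine_matrix_def motion_group_def matrix_matrix_mult_def vec_eq_iff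
        forall_2 sum_2 case_prod_beta)

lemma affine_matrix_one: "affine_matrix \<one>\<^bsub>motion_group\<^esub> = mat 1"
  by (simp add: affine_matrix_def motion_group_def mat_def vec_eq_iff forall_2)

lemma group_motion_group: "group motion_group"
proof (rule groupI)
  fix g assume g: "g \<in> carrier motion_group"
  have "cnj (fst g) * fst g = 1"
    using g complex_norm_square[of "fst g"]
    by (auto simp: motion_group_def mult.commute)
  then show "\<exists>h\<in>carrier motion_group. h \<otimes>\<^bsub>motion_group\<^esub> g = \<one>\<^bsub>motion_group\<^esub>"
    using g
    by (intro bexI[of _ "(cnj (fst g), - cnj (fst g) * snd g)"])
       (auto simp: motion_group_def)
qed (auto simp: motion_group_def norm_mult algebra_simps)

lemma act_mult: "act (g \<otimes>\<^bsub>motion_group\<^esub> h) z = act g (act h z)"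
  by (simp add: act_def motion_group_def case_prod_beta algebra_simps)

definition herm :: "complex \<Rightarrow> complex \<Rightarrow> complex" where
  "herm z w = z * cnj w"

definition j :: "real \<Rightarrow> complex \<times> complex \<Rightarrow> complex \<Rightarrow> complex" where
  "j \<alpha> g z = exp (2 * \<i> * of_real (\<alpha> * Im (herm z (act (inv\<^bsub>motion_group\<^esub> g) 0))))"

section \<open>Uniform lattices\<close>

text \<open>
  In the last clause, \<open>X\<close> is the quotient topology on the set of cosets of \<open>\<Gamma>\<close>: it is
  uniquely determined by the requirement that the coset map be a quotient map.
\<close>

definition uniform_lattice :: "complex set \<Rightarrow> bool" where
  "uniform_lattice \<Gamma> \<longleftrightarrow>
     0 \<in> \<Gamma> \<and> (\<forall>x\<in>\<Gamma>. \<forall>y\<in>\<Gamma>. x + y \<in> \<Gamma>) \<and> (\<forall>x\<in>\<Gamma>. - x \<in> \<Gamma>) \<and>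
     discrete \<Gamma> \<and>
     (\<exists>X. quotient_map euclidean X (\<lambda>z. (\<lambda>\<gamma>. z + \<gamma>) ` \<Gamma>) \<and> compact_space X)"

section \<open>Real smooth maps and Wirtinger derivatives\<close>

text \<open>
  Differentiability is over the reals.  On a finite-dimensional domain, \<open>C_k k f\<close> is the usual
  \<open>C\<^sup>k\<close> condition: all iterated directional derivatives up to order \<open>k\<close> exist and are continuous.
\<close>

fun C_k :: "nat \<Rightarrow> ('a::real_normed_vector \<Rightarrow> 'b::real_normed_vector) \<Rightarrow> bool" where
  "C_k 0 f \<longleftrightarrow> continuous_on UNIV f"
| "C_k (Suc k) f \<longleftrightarrow>
     (\<forall>x. f differentiable (at x)) \<and> (\<forall>v. C_k k (\<lambda>x. frechet_derivative f (at x) v))"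

definition smooth :: "('a::real_normed_vector \<Rightarrow> 'b::real_normed_vector) \<Rightarrow> bool" where
  "smooth f \<longleftrightarrow> (\<forall>k. C_k k f)"

definition d_z :: "(complex \<Rightarrow> complex) \<Rightarrow> complex \<Rightarrow> complex" where
  "d_z f z = (frechet_derivative f (at z) 1 - \<i> * frechet_derivative f (at z) \<i>) / 2"

definition d_zbar :: "(complex \<Rightarrow> complex) \<Rightarrow> complex \<Rightarrow> complex" where
  "d_zbar f z = (frechet_derivative f (at z) 1 + \<i> * frechet_derivative f (at z) \<i>) / 2"

section \<open>Mixed automorphic forms and Landau automorphic functions\<close>

definition equivariant_pair ::
  "(complex \<times> complex \<Rightarrow> complex \<times> complex) \<Rightarrow> (complex \<Rightarrow> complex) \<Rightarrow> bool" where
  "equivariant_pair \<rho> \<tau> \<longleftrightarrow>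
     \<rho> \<in> hom motion_group motion_group \<and> smooth \<tau> \<and>
     (\<forall>g\<in>carrier motion_group. \<forall>z. \<tau> (act g z) = act (\<rho> g) (\<tau> z))"

definition mixed_forms ::
  "complex set \<Rightarrow> (complex \<times> complex \<Rightarrow> complex \<times> complex) \<Rightarrow> (complex \<Rightarrow> complex) \<Rightarrow>
   real \<Rightarrow> real \<Rightarrow> (complex \<Rightarrow> complex) set" where
  "mixed_forms \<Gamma> \<rho> \<tau> \<nu> \<mu> =
     {F. smooth F \<and>
         (\<forall>\<gamma>\<in>\<Gamma>. \<forall>z. F (z + \<gamma>) =
            j (- \<nu>) (translation \<gamma>) z * j (- \<mu>) (\<rho> (translation \<gamma>)) (\<tau> z) * F z)}"

definition landau_functions ::
  "complex set \<Rightarrow> (complex \<Rightarrow> complex) \<Rightarrow> real \<Rightarrow> (complex \<Rightarrow> complex) set" where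
  "landau_functions \<Gamma> ch B =
     {F. smooth F \<and>
         (\<forall>\<gamma>\<in>\<Gamma>. \<forall>z. F (z + \<gamma>) = ch \<gamma> * j (- B) (translation \<gamma>) z * F z)}"

text \<open>
  The density below does not depend on the point when \<open>\<tau>\<close> belongs to an equivariant pair
  (\<open>magnitude_eq\<close>); \<open>magnitude\<close> is its constant value.
\<close>

definition magnitude_density :: "real \<Rightarrow> real \<Rightarrow> (complex \<Rightarrow> complex) \<Rightarrow> complex \<Rightarrow> real" where
  "magnitude_density \<nu> \<mu> \<tau> z = \<nu> + \<mu> * ((cmod (d_z \<tau> z))\<^sup>2 - (cmod (d_zbar \<tau> z))\<^sup>2)"

definition magnitude :: "real \<Rightarrow> real \<Rightarrow> (complex \<Rightarrow> complex) \<Rightarrow> real" where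
  "magnitude \<nu> \<mu> \<tau> = (THE B. \<forall>z. magnitude_density \<nu> \<mu> \<tau> z = B)"

definition S :: "real \<Rightarrow> real \<Rightarrow> (complex \<Rightarrow> complex) \<Rightarrow> complex \<Rightarrow> complex" where
  "S \<nu> \<mu> \<tau> z = of_real \<nu> * z +
     of_real \<mu> * (\<tau> z * d_zbar (\<lambda>w. cnj (\<tau> w)) z - cnj (\<tau> z) * d_zbar \<tau> z)"

definition phase :: "real \<Rightarrow> real \<Rightarrow> (complex \<Rightarrow> complex) \<Rightarrow> complex \<Rightarrow> real" where
  "phase \<nu> \<mu> \<tau> = (THE \<phi>. smooth \<phi> \<and> \<phi> 0 = 0 \<and>
     (\<forall>z. d_zbar (\<lambda>w. of_real (\<phi> w)) z =
            - \<i> * (S \<nu> \<mu> \<tau> z - of_real (magnitude \<nu> \<mu> \<tau>) * z)))"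

definition W ::
  "real \<Rightarrow> real \<Rightarrow> (complex \<Rightarrow> complex) \<Rightarrow> (complex \<Rightarrow> complex) \<Rightarrow> complex \<Rightarrow> complex" where
  "W \<nu> \<mu> \<tau> f z = exp (\<i> * of_real (phase \<nu> \<mu> \<tau> z)) * f z"

definition multiplier ::
  "real \<Rightarrow> real \<Rightarrow> (complex \<times> complex \<Rightarrow> complex \<times> complex) \<Rightarrow> (complex \<Rightarrow> complex) \<Rightarrow>
   complex \<Rightarrow> complex" where
  "multiplier \<nu> \<mu> \<rho> \<tau> \<gamma> =
     exp (\<i> * of_real (phase \<nu> \<mu> \<tau> \<gamma>) -
          2 * \<i> * of_real (\<mu> * Im (herm (\<tau> 0)
             (act (inv\<^bsub>motion_group\<^esub> (\<rho> (translation \<gamma>))) 0))))"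

lemma magnitude_eq:
  assumes "equivariant_pair \<rho> \<tau>"
  shows "magnitude_density \<nu> \<mu> \<tau> z = magnitude \<nu> \<mu> \<tau>"
proof -
  have const: "magnitude_density \<nu> \<mu> \<tau> w = magnitude_density \<nu> \<mu> \<tau> 0" for w
  proof -
    have diff: "\<tau> differentiable (at x)" for x
      using assms C_k.simps(2)[of 0 \<tau>] unfolding equivariant_pair_def smooth_def by blast
    have T: "translation w \<in> carrier motion_group"
      by (simp add: translation_def motion_group_def)
    define a where "a = fst (\<rho> (translation w))"
    define b where "b = snd (\<rho> (translation w))"
    have "\<rho> (translation w) \<in> carrier motion_group"
      using assms T unfolding equivariant_pair_def hom_def by blast
    then have a: "cmod a = 1"
      by (auto simp: motion_group_def a_def)
    have eq: "\<tau> (x + w) = a * \<tau> x + b" for x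
    proof -
      have "\<tau> (act (translation w) x) = act (\<rho> (translation w)) (\<tau> x)"
        using assms T unfolding equivariant_pair_def by blast
      then show ?thesis
        by (simp add: act_def translation_def a_def b_def)
    qed
    have D0: "(\<tau> has_derivative frechet_derivative \<tau> (at 0)) (at 0)"
      and Dw: "(\<tau> has_derivative frechet_derivative \<tau> (at w)) (at w)"
      using diff frechet_derivative_works by blast+
    have 1: "((\<lambda>x. \<tau> (x + w)) has_derivative frechet_derivative \<tau> (at w)) (at 0)"
    proof -
      have "((\<lambda>x. x + w) has_derivative (\<lambda>h. h)) (at 0)"
        by (auto intro!: derivative_eq_intros)
      then show ?thesis
        using has_derivative_compose[of "\<lambda>x. x + w" "\<lambda>h. h" 0 UNIV \<tau>] Dw by simp
    qed
    have 2: "((\<lambda>x. \<tau> (x + w)) has_derivative (\<lambda>h. a * frechet_derivative \<tau> (at 0) h)) (at 0)"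
      unfolding eq using D0 by (auto intro!: derivative_eq_intros)
    have fd: "frechet_derivative \<tau> (at w) h = a * frechet_derivative \<tau> (at 0) h" for h
      using has_derivative_unique[OF 1 2] by metis
    have "d_z \<tau> w = a * d_z \<tau> 0" "d_zbar \<tau> w = a * d_zbar \<tau> 0"
      by (simp_all add: d_z_def d_zbar_def fd field_simps)
    then show ?thesis
      by (simp add: magnitude_density_def norm_mult a)
  qed
  have "magnitude \<nu> \<mu> \<tau> = magnitude_density \<nu> \<mu> \<tau> 0"
    unfolding magnitude_def using const by (intro the_equality) metis+
  then show ?thesis
    using const by simp
qed

end

theory Submission
  imports Defs
begin

text \<open>
  The point is that \<open>\<tau>\<close> is forced to be very simple.  Translations are conjugated to their
  inverses by the rotation \<open>z \<mapsto> -z\<close>, the rotation part of a motion takes values in an abelian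
  group, and every translation is the square of another one; hence \<open>\<rho>\<close> sends translations to translations
  (\<open>fst_hom_translation\<close>).  Equivariance then says that \<open>\<tau>\<close> commutes with translations up to
  additive constants, so its derivative is constant and
  \<open>\<tau> z = A z + c\<close> with \<open>A z = p z + q (cnj z)\<close>
  (\<open>equivariant_pair_affine\<close>).

  The real-linear map \<open>A\<close> scales the symplectic form \<open>Im \<langle>z, w\<rangle>\<close> by its determinant
  \<open>|p|\<^sup>2 - |q|\<^sup>2\<close> (\<open>Im_herm_real_linear\<close>).  This has two consequences.  In the equation for the
  phase everything cancels except the contribution of \<open>c\<close>, and the phase is the real-linear
  function \<open>z \<mapsto> 2 \<mu> Im \<langle>c, A z\<rangle>\<close> (\<open>phase_affine\<close>).  And in the factor of automorphy
  \<open>j\<close> of weight \<open>-\<mu>\<close> at \<open>(\<rho> \<gamma>, \<tau> z)\<close>, whose argument is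
  \<open>2 \<mu> Im \<langle>A z + c, A \<gamma>\<rangle>\<close>, the part depending on \<open>z\<close> is the
  factor of automorphy of weight \<open>-\<mu> (|p|\<^sup>2 - |q|\<^sup>2)\<close> at \<open>(\<gamma>, z)\<close>.  It combines with the weight
  \<open>-\<nu>\<close> factor to weight \<open>-B\<close>, and the constant \<open>2 \<mu> Im \<langle>c, A \<gamma>\<rangle>\<close> goes into the multiplier.
  Since the phase is additive, multiplying by its exponential contributes just the remaining
  constant \<open>exp (i \<phi>(\<gamma>))\<close>, and this multiplication is a bijection on smooth functions.
\<close>

section \<open>Functions of class C^k\<close>

lemma C_k_Suc_imp:
  "C_k (Suc k) f \<Longrightarrow> C_k k f"
proof (induction k arbitrary: f)
  case 0
  then show ?case
    by (simp add: continuous_on_eq_continuous_within differentiable_imp_continuous_within)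
next
  case (Suc k)
  then show ?case
    using C_k.simps(2) by blast
qed

lemma C_k_const: "C_k k (\<lambda>x. c)"
  by (induction k arbitrary: c) auto

lemma C_k_bounded_linear:
  assumes "bounded_linear L"
  shows "C_k k L"
proof (cases k)
  case 0
  then show ?thesis
    using assms by (simp add: linear_continuous_on)
next
  case (Suc n)
  have D: "(L has_derivative L) (at x)" for x
    using assms by (rule bounded_linear_imp_has_derivative)
  then have "frechet_derivative L (at x) = L" for x
    using frechet_derivative_at by metis
  then show ?thesis
    unfolding Suc using D by (auto simp: C_k_const differentiable_def)
qed

lemma C_k_add:
  "C_k k f \<Longrightarrow> C_k k g \<Longrightarrow> C_k k (\<lambda>x. f x + g x)"
proof (induction k arbitrary: f g)
  case 0
  then show ?case by (auto intro: continuous_on_add)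
next
  case (Suc k)
  have "frechet_derivative (\<lambda>x. f x + g x) (at x)
      = (\<lambda>v. frechet_derivative f (at x) v + frechet_derivative g (at x) v)" for x
    using Suc.prems frechet_derivative_works[of f "at x"] frechet_derivative_works[of g "at x"]
    by (intro frechet_derivative_at[symmetric] has_derivative_add) auto
  then show ?case
    using Suc by auto
qed

lemma C_k_cmult:
  fixes f :: "'a::real_normed_vector \<Rightarrow> complex"
  shows "C_k k f \<Longrightarrow> C_k k (\<lambda>x. a * f x)"
proof (induction k arbitrary: f)
  case 0
  then show ?case by (auto intro: continuous_intros)
next
  case (Suc k)
  have "frechet_derivative (\<lambda>x. a * f x) (at x) = (\<lambda>v. a * frechet_derivative f (at x) v)" for x
    using Suc.prems frechet_derivative_works[of f "at x"]
    by (intro frechet_derivative_at[symmetric] has_derivative_mult_right) auto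
  then show ?case
    using Suc by auto
qed

text \<open>
  Differentiating the product gives the same exponential times a function with one
  derivative less, so the induction goes through without a general product or chain rule.
\<close>

lemma C_k_exp_linear_mult:
  fixes f :: "'a::real_normed_vector \<Rightarrow> complex"
  assumes L: "bounded_linear (L :: 'a \<Rightarrow> real)"
  shows "C_k k f \<Longrightarrow> C_k k (\<lambda>x. exp (\<i> * of_real (L x)) * f x)"
proof (induction k arbitrary: f)
  case 0
  then show ?case
    using linear_continuous_on[OF L, of UNIV] by (auto intro!: continuous_intros)
next
  case (Suc k)
  let ?g = "\<lambda>v x. \<i> * of_real (L v) * f x + frechet_derivative f (at x) v"
  have D: "((\<lambda>x. exp (\<i> * of_real (L x)) * f x) has_derivative
      (\<lambda>v. exp (\<i> * of_real (L x)) * ?g v x)) (at x)" for x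
  proof -
    have "(f has_derivative frechet_derivative f (at x)) (at x)"
      using Suc.prems frechet_derivative_works by auto
    moreover have "((\<lambda>x. exp (\<i> * of_real (L x))) has_derivative
        (\<lambda>v. \<i> * of_real (L v) * exp (\<i> * of_real (L x)))) (at x)"
    proof -
      have "((\<lambda>x. \<i> * complex_of_real (L x)) has_derivative (\<lambda>v. \<i> * of_real (L v))) (at x)"
        by (intro has_derivative_mult_right has_derivative_of_real
            bounded_linear_imp_has_derivative L)
      from has_derivative_compose[OF this DERIV_exp[unfolded has_field_derivative_def]]
      show ?thesis
        by (simp add: mult.commute)
    qed
    ultimately show ?thesis
      by (auto intro!: derivative_eq_intros simp: algebra_simps)
  qed
  have "C_k k (\<lambda>x. exp (\<i> * of_real (L x)) * ?g v x)" for v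
    using Suc.prems by (intro Suc.IH C_k_add C_k_cmult C_k_Suc_imp[OF Suc.prems]) auto
  moreover have "frechet_derivative (\<lambda>x. exp (\<i> * of_real (L x)) * f x) (at x)
      = (\<lambda>v. exp (\<i> * of_real (L x)) * ?g v x)" for x
    using frechet_derivative_at[OF D] by simp
  ultimately show ?case
    using D by (auto simp: differentiable_def)
qed

section \<open>Equivariant maps are real-affine\<close>

lemma fst_hom_mult:
  assumes "\<rho> \<in> hom motion_group motion_group" "cmod a = 1" "cmod c = 1"
  shows "fst (\<rho> (a * c, a * d + b)) = fst (\<rho> (a, b)) * fst (\<rho> (c, d))"
  using hom_mult[OF assms(1), of "(a, b)" "(c, d)"] assms(2,3)
  by (simp add: motion_group_def case_prod_beta)

lemma cmod_fst_hom:
  assumes "\<rho> \<in> hom motion_group motion_group" "cmod a = 1"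
  shows "cmod (fst (\<rho> (a, b))) = 1"
  using hom_in_carrier[OF assms(1), of "(a, b)"] assms(2)
  by (auto simp: motion_group_def)

text \<open>
  Let \<open>\<alpha> w\<close> be the rotation part of the image of the translation by \<open>w\<close>.  Conjugating by
  \<open>z \<mapsto> -z\<close> gives \<open>\<alpha> (- w) = \<alpha> w\<close>, so \<open>\<alpha> w = \<alpha> (w/2) \<alpha> (w/2) = \<alpha> (w/2) \<alpha> (- w/2) = 1\<close>.
\<close>

lemma fst_hom_translation:
  assumes hom: "\<rho> \<in> hom motion_group motion_group"
  shows "fst (\<rho> (translation w)) = 1"
proof -
  define \<alpha> where "\<alpha> v = fst (\<rho> (1, v))" for v
  define r where "r = fst (\<rho> (- 1, 0))"
  have add: "\<alpha> (u + v) = \<alpha> u * \<alpha> v" for u v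
    using fst_hom_mult[OF hom, of 1 1 u v] by (simp add: \<alpha>_def mult.commute add.commute)
  have nz: "\<alpha> v \<noteq> 0" "r \<noteq> 0" for v
    using cmod_fst_hom[OF hom, of 1 v] cmod_fst_hom[OF hom, of "- 1" 0]
    by (auto simp: \<alpha>_def r_def)
  have "\<alpha> 0 = 1"
    using add[of 0 0] nz(1)[of 0] by simp
  have even: "\<alpha> (- v) = \<alpha> v" for v
    using fst_hom_mult[OF hom, of "- 1" 1 v 0] fst_hom_mult[OF hom, of 1 "- 1" 0 "- v"] nz(2)
    by (simp add: \<alpha>_def r_def)
  have "\<alpha> w = \<alpha> (w/2) * \<alpha> (w/2)"
    using add[of "w/2" "w/2"] by simp
  also have "\<dots> = \<alpha> (w/2) * \<alpha> (- (w/2))"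
    by (simp only: even)
  also have "\<dots> = 1"
    using add[of "w/2" "- (w/2)"] \<open>\<alpha> 0 = 1\<close> by simp
  finally show ?thesis
    by (simp add: \<alpha>_def translation_def)
qed

lemma equivariant_pair_translation:
  assumes "equivariant_pair \<rho> \<tau>"
  shows "\<rho> (translation w) = translation (\<tau> w - \<tau> 0)"
    and "\<tau> (z + w) = \<tau> z + (\<tau> w - \<tau> 0)"
proof -
  have fst1: "fst (\<rho> (translation w)) = 1"
    using assms fst_hom_translation unfolding equivariant_pair_def by blast
  have *: "\<tau> (x + w) = \<tau> x + snd (\<rho> (translation w))" for x
  proof -
    have "\<tau> (act (translation w) x) = act (\<rho> (translation w)) (\<tau> x)"
      using assms unfolding equivariant_pair_def by (simp add: translation_def motion_group_def)
    then show ?thesis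
      using fst1 by (simp add: act_def translation_def)
  qed
  show "\<tau> (z + w) = \<tau> z + (\<tau> w - \<tau> 0)"
    using *[of z] *[of 0] by simp
  show "\<rho> (translation w) = translation (\<tau> w - \<tau> 0)"
    using *[of 0] fst1 by (simp add: translation_def prod_eq_iff)
qed

lemma real_linear_Wirtinger:
  fixes D :: "complex \<Rightarrow> complex"
  assumes "linear D"
  shows "D h = (D 1 - \<i> * D \<i>) / 2 * h + (D 1 + \<i> * D \<i>) / 2 * cnj h"
proof -
  have "h = Re h *\<^sub>R 1 + Im h *\<^sub>R \<i>"
    by (simp add: complex_eq_iff)
  then have "D h = D (Re h *\<^sub>R 1 + Im h *\<^sub>R \<i>)"
    by (rule arg_cong)
  also have "\<dots> = Re h *\<^sub>R D 1 + Im h *\<^sub>R D \<i>"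
    by (simp only: linear_add[OF assms] linear_scale[OF assms])
  also have "\<dots> = (D 1 - \<i> * D \<i>) / 2 * h + (D 1 + \<i> * D \<i>) / 2 * cnj h"
    by (simp add: complex_eq_iff field_simps)
  finally show ?thesis .
qed

lemma equivariant_pair_affine:
  assumes eq: "equivariant_pair \<rho> \<tau>"
  obtains p q c where "\<tau> = (\<lambda>z. p * z + q * cnj z + c)"
proof -
  define D where "D = frechet_derivative \<tau> (at 0)"
  have "\<tau> differentiable (at 0)"
    using eq C_k.simps(2)[of 0 \<tau>] unfolding equivariant_pair_def smooth_def by blast
  then have D0: "(\<tau> has_derivative D) (at 0)"
    unfolding D_def using frechet_derivative_works by blast
  have Dw: "(\<tau> has_derivative D) (at w)" for w
  proof -
    have shift: "\<tau> = (\<lambda>x. \<tau> (x - w) + (\<tau> w - \<tau> 0))"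
    proof
      fix x
      show "\<tau> x = \<tau> (x - w) + (\<tau> w - \<tau> 0)"
        using equivariant_pair_translation(2)[OF eq, of "x - w" w] by simp
    qed
    have "((\<lambda>x. \<tau> (x - w)) has_derivative D) (at w)"
    proof -
      have "((\<lambda>x. x - w) has_derivative (\<lambda>h. h)) (at w)"
        by (auto intro!: derivative_eq_intros)
      then show ?thesis
        using has_derivative_compose[of "\<lambda>x. x - w" "\<lambda>h. h" w UNIV \<tau> D] D0 by simp
    qed
    then show ?thesis
      by (subst shift) (auto intro!: derivative_eq_intros)
  qed
  have lin: "linear D"
    using D0 has_derivative_linear by blast
  have "((\<lambda>x. \<tau> x - D x) has_derivative (\<lambda>h. 0)) (at x)" for x
    using has_derivative_diff[OF Dw[of x] bounded_linear_imp_has_derivative[of D]] D0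
    by (auto dest: has_derivative_bounded_linear)
  then obtain c where "\<And>x. \<tau> x - D x = c"
    using has_derivative_zero_constant[of UNIV "\<lambda>x. \<tau> x - D x"] by auto
  then have "\<tau> z = (D 1 - \<i> * D \<i>) / 2 * z + (D 1 + \<i> * D \<i>) / 2 * cnj z + c" for z
    using real_linear_Wirtinger[OF lin, of z] by (metis diff_add_cancel add.commute)
  then show thesis
    by (intro that) blast
qed

section \<open>The phase of an affine map\<close>

lemma Im_herm_real_linear:
  "Im (herm (p * z + q * cnj z) (p * w + q * cnj w))
    = ((cmod p)\<^sup>2 - (cmod q)\<^sup>2) * Im (herm z w)"
  unfolding cmod_power2 herm_def by (simp add: algebra_simps power2_eq_square)

lemma frechet_derivative_affine:
  "frechet_derivative (\<lambda>z. p * z + q * cnj z + c) (at z) = (\<lambda>h. p * h + q * cnj h)"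
  by (intro frechet_derivative_at[symmetric])
     (auto intro!: derivative_eq_intros bounded_linear_imp_has_derivative bounded_linear_cnj)

lemma Wirtinger_affine:
  shows "d_z (\<lambda>z. p * z + q * cnj z + c) z = p"
    and "d_zbar (\<lambda>z. p * z + q * cnj z + c) z = q"
  unfolding d_z_def d_zbar_def frechet_derivative_affine by (simp_all add: algebra_simps)

lemma magnitude_affine:
  "magnitude \<nu> \<mu> (\<lambda>z. p * z + q * cnj z + c) = \<nu> + \<mu> * ((cmod p)\<^sup>2 - (cmod q)\<^sup>2)"
  unfolding magnitude_def magnitude_density_def Wirtinger_affine by simp

lemma S_affine:
  "S \<nu> \<mu> (\<lambda>z. p * z + q * cnj z + c) z
    = of_real \<nu> * z + of_real \<mu> * ((p * z + q * cnj z + c) * cnj p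
                                    - cnj (p * z + q * cnj z + c) * q)"
proof -
  have "(\<lambda>w. cnj (p * w + q * cnj w + c)) = (\<lambda>w. cnj q * w + cnj p * cnj w + cnj c)"
    by (simp add: algebra_simps)
  then show ?thesis
    by (simp add: S_def Wirtinger_affine)
qed

text \<open>
  The real and imaginary parts of the conjugate Wirtinger derivative of a real-valued function
  are half its two partial derivatives, so this derivative alone determines the gradient.
\<close>

lemma real_eq_if_d_zbar_eq:
  fixes f g :: "complex \<Rightarrow> real"
  assumes f: "\<And>z. f differentiable (at z)" and g: "\<And>z. g differentiable (at z)"
    and d: "\<And>z. d_zbar (\<lambda>w. of_real (f w)) z = d_zbar (\<lambda>w. of_real (g w)) z"
    and "f 0 = g 0"
  shows "f = g"
proof -
  have of_real_D: "frechet_derivative (\<lambda>w. complex_of_real (h w)) (at z)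
      = (\<lambda>v. of_real (frechet_derivative h (at z) v))"
    if "h differentiable (at z)" for h :: "complex \<Rightarrow> real" and z
    using that frechet_derivative_works[of h "at z"]
    by (intro frechet_derivative_at[symmetric] has_derivative_of_real) auto
  have "frechet_derivative f (at z) v = frechet_derivative g (at z) v" for z v
  proof -
    have lin: "linear (frechet_derivative f (at z))" "linear (frechet_derivative g (at z))"
      using f g by (auto intro: linear_frechet_derivative)
    have "frechet_derivative f (at z) 1 = frechet_derivative g (at z) 1 \<and>
        frechet_derivative f (at z) \<i> = frechet_derivative g (at z) \<i>"
      using d[of z] unfolding d_zbar_def of_real_D[OF f] of_real_D[OF g]
      by (simp add: complex_eq_iff)
    moreover have "v = Re v *\<^sub>R 1 + Im v *\<^sub>R \<i>"
      by (simp add: complex_eq_iff)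
    ultimately show ?thesis
      by (metis linear_add[OF lin(1)] linear_add[OF lin(2)]
          linear_scale[OF lin(1)] linear_scale[OF lin(2)])
  qed
  then have "((\<lambda>z. f z - g z) has_derivative (\<lambda>h. 0)) (at z)" for z
    using has_derivative_diff[of f "frechet_derivative f (at z)" "at z" g
        "frechet_derivative g (at z)"] f[of z] g[of z]
    by (simp add: frechet_derivative_works)
  then obtain c where "\<And>z. f z - g z = c"
    using has_derivative_zero_constant[of UNIV "\<lambda>z. f z - g z"] by auto
  then show ?thesis
    using \<open>f 0 = g 0\<close> by (metis eq_iff_diff_eq_0 ext)
qed

lemma bounded_linear_Im_herm:
  "bounded_linear (\<lambda>z. 2 * \<mu> * Im (herm c (p * z + q * cnj z)))"
  unfolding herm_def
  by (intro bounded_linear_mult_right[THEN bounded_linear_compose]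
      bounded_linear_Im[THEN bounded_linear_compose]
      bounded_linear_cnj[THEN bounded_linear_compose]
      bounded_linear_add bounded_linear_cnj bounded_linear_mult_right)

lemma phase_affine:
  "phase \<nu> \<mu> (\<lambda>z. p * z + q * cnj z + c) = (\<lambda>z. 2 * \<mu> * Im (herm c (p * z + q * cnj z)))"
    (is "phase _ _ ?\<tau> = ?\<phi>")
proof -
  let ?solves = "\<lambda>\<phi>. smooth \<phi> \<and> \<phi> 0 = 0 \<and>
     (\<forall>z. d_zbar (\<lambda>w. of_real (\<phi> w)) z =
            - \<i> * (S \<nu> \<mu> ?\<tau> z - of_real (magnitude \<nu> \<mu> ?\<tau>) * z))"
  have differentiable: "\<phi> differentiable (at z)" if "?solves \<phi>" for \<phi> z
    using that C_k.simps(2)[of 0 \<phi>] unfolding smooth_def by blast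
  have "d_zbar (\<lambda>w. of_real (?\<phi> w)) z
      = - \<i> * (S \<nu> \<mu> ?\<tau> z - of_real (magnitude \<nu> \<mu> ?\<tau>) * z)" for z
  proof -
    \<comment> \<open>Twice the imaginary part of \<open>x\<close> is \<open>x\<close> minus its conjugate, divided by the imaginary unit;
      so \<open>\<phi>\<close> has Wirtinger form.\<close>
    have "(\<lambda>w. complex_of_real (?\<phi> w)) =
      (\<lambda>w. (- \<i> * \<mu> * (c * cnj q - cnj c * p)) * w + (- \<i> * \<mu> * (c * cnj p - cnj c * q)) * cnj w + 0)"
      by (rule ext) (simp add: herm_def complex_eq_iff algebra_simps)
    then have "d_zbar (\<lambda>w. of_real (?\<phi> w)) z = - \<i> * \<mu> * (c * cnj p - cnj c * q)"
      by (simp only: Wirtinger_affine)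
    also have "\<dots> = - \<i> * (S \<nu> \<mu> ?\<tau> z - of_real (magnitude \<nu> \<mu> ?\<tau>) * z)"
      unfolding S_affine magnitude_affine
      by (simp add: complex_norm_square algebra_simps del: of_real_power)
    finally show ?thesis .
  qed
  moreover have "smooth ?\<phi>"
    unfolding smooth_def using C_k_bounded_linear[OF bounded_linear_Im_herm] by blast
  ultimately have sol: "?solves ?\<phi>"
    by (simp add: herm_def)
  show ?thesis
    unfolding phase_def
  proof (rule the_equality)
    show "?solves ?\<phi>"
      by (rule sol)
  next
    fix \<phi> assume \<phi>: "?solves \<phi>"
    then show "\<phi> = ?\<phi>"
      using sol differentiable[OF \<phi>] differentiable[OF sol]
      by (intro real_eq_if_d_zbar_eq) auto
  qed
qed

section \<open>The factors of automorphy\<close>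

lemma inv_translation: "inv\<^bsub>motion_group\<^esub> (translation b) = translation (- b)"
  by (rule group.inv_equality[OF group_motion_group])
     (auto simp: motion_group_def translation_def)

lemma j_translation: "j (- \<alpha>) (translation b) z = exp (2 * \<i> * of_real (\<alpha> * Im (herm z b)))"
  unfolding j_def inv_translation
  by (simp add: act_def translation_def herm_def algebra_simps)

text \<open>
  The identity that matches the two functional equations: twisting the mixed factor of
  automorphy by the phase gives the Landau factor with its multiplier.
\<close>

lemma phase_twisted_factor:
  assumes eq: "equivariant_pair \<rho> \<tau>"
  shows "exp (\<i> * of_real (phase \<nu> \<mu> \<tau> (z + \<gamma>))) *
      (j (- \<nu>) (translation \<gamma>) z * j (- \<mu>) (\<rho> (translation \<gamma>)) (\<tau> z))
    = multiplier \<nu> \<mu> \<rho> \<tau> \<gamma> * j (- magnitude \<nu> \<mu> \<tau>) (translation \<gamma>) z *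
      exp (\<i> * of_real (phase \<nu> \<mu> \<tau> z))"
proof -
  obtain p q c where \<tau>: "\<tau> = (\<lambda>z. p * z + q * cnj z + c)"
    using equivariant_pair_affine[OF eq] by blast
  let ?A = "\<lambda>z. p * z + q * cnj z"
  have \<rho>: "\<rho> (translation \<gamma>) = translation (?A \<gamma>)"
    using equivariant_pair_translation(1)[OF eq] by (simp add: \<tau>)
  have phase: "phase \<nu> \<mu> \<tau> w = 2 * \<mu> * Im (herm c (?A w))" for w
    by (simp only: \<tau> phase_affine)
  have phase_add: "phase \<nu> \<mu> \<tau> (z + \<gamma>) = phase \<nu> \<mu> \<tau> z + phase \<nu> \<mu> \<tau> \<gamma>"
    unfolding phase by (simp add: herm_def algebra_simps)
  have mult: "multiplier \<nu> \<mu> \<rho> \<tau> \<gamma>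
      = exp (\<i> * of_real (phase \<nu> \<mu> \<tau> \<gamma>) + 2 * \<i> * of_real (\<mu> * Im (herm c (?A \<gamma>))))"
    unfolding multiplier_def \<rho> inv_translation
    by (simp add: \<tau> act_def translation_def herm_def algebra_simps)
  have "Im (herm (\<tau> z) (?A \<gamma>)) = Im (herm (?A z) (?A \<gamma>)) + Im (herm c (?A \<gamma>))"
    by (simp add: \<tau> herm_def algebra_simps)
  then have split: "\<nu> * Im (herm z \<gamma>) + \<mu> * Im (herm (\<tau> z) (?A \<gamma>))
      = magnitude \<nu> \<mu> \<tau> * Im (herm z \<gamma>) + \<mu> * Im (herm c (?A \<gamma>))"
    unfolding Im_herm_real_linear by (simp only: \<tau> magnitude_affine) (simp add: algebra_simps)
  have "j (- \<nu>) (translation \<gamma>) z * j (- \<mu>) (\<rho> (translation \<gamma>)) (\<tau> z)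
      = exp (2 * \<i> * of_real (\<nu> * Im (herm z \<gamma>) + \<mu> * Im (herm (\<tau> z) (?A \<gamma>))))"
    unfolding \<rho> j_translation by (simp add: exp_add[symmetric] algebra_simps)
  then show ?thesis
    unfolding split mult phase_add j_translation
    by (simp add: exp_add[symmetric] algebra_simps)
qed

lemma smooth_exp_phase_mult:
  assumes "equivariant_pair \<rho> \<tau>" "smooth F"
  shows "smooth (\<lambda>z. exp (\<i> * of_real (phase \<nu> \<mu> \<tau> z)) * F z)"
    and "smooth (\<lambda>z. exp (- \<i> * of_real (phase \<nu> \<mu> \<tau> z)) * F z)"
proof -
  obtain p q c where "\<tau> = (\<lambda>z. p * z + q * cnj z + c)"
    using equivariant_pair_affine[OF assms(1)] by blast
  then have L: "bounded_linear (phase \<nu> \<mu> \<tau>)"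
    using bounded_linear_Im_herm by (simp only: phase_affine)
  show "smooth (\<lambda>z. exp (\<i> * of_real (phase \<nu> \<mu> \<tau> z)) * F z)"
    using C_k_exp_linear_mult[OF L] assms(2) by (simp add: smooth_def)
  show "smooth (\<lambda>z. exp (- \<i> * of_real (phase \<nu> \<mu> \<tau> z)) * F z)"
    using C_k_exp_linear_mult[OF bounded_linear_minus[OF L]] assms(2) by (simp add: smooth_def)
qed

theorem theorem3p3:
  fixes \<Gamma> :: "complex set"
    and \<rho> :: "complex \<times> complex \<Rightarrow> complex \<times> complex"
    and \<tau> :: "complex \<Rightarrow> complex"
    and \<nu> \<mu> :: real
  assumes "uniform_lattice \<Gamma>"
    and "equivariant_pair \<rho> \<tau>"
    and "\<nu> > 0" and "\<mu> > 0"
  shows "W \<nu> \<mu> \<tau> ` mixed_forms \<Gamma> \<rho> \<tau> \<nu> \<mu> =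
         landau_functions \<Gamma> (multiplier \<nu> \<mu> \<rho> \<tau>) (magnitude \<nu> \<mu> \<tau>)"
proof -
  let ?e = "\<lambda>z. exp (\<i> * of_real (phase \<nu> \<mu> \<tau> z))"
  let ?J = "\<lambda>\<gamma> z. j (- \<nu>) (translation \<gamma>) z * j (- \<mu>) (\<rho> (translation \<gamma>)) (\<tau> z)"
  let ?K = "\<lambda>\<gamma> z. multiplier \<nu> \<mu> \<rho> \<tau> \<gamma> * j (- magnitude \<nu> \<mu> \<tau>) (translation \<gamma>) z"
  have W: "W \<nu> \<mu> \<tau> f = (\<lambda>z. ?e z * f z)" for f
    by (rule ext) (simp add: W_def)
  have W_mixed_iff: "W \<nu> \<mu> \<tau> f \<in> landau_functions \<Gamma> (multiplier \<nu> \<mu> \<rho> \<tau>) (magnitude \<nu> \<mu> \<tau>)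
      \<longleftrightarrow> f \<in> mixed_forms \<Gamma> \<rho> \<tau> \<nu> \<mu>" if f: "smooth f" for f
  proof -
    have "W \<nu> \<mu> \<tau> f (z + \<gamma>) = ?K \<gamma> z * W \<nu> \<mu> \<tau> f z \<longleftrightarrow> f (z + \<gamma>) = ?J \<gamma> z * f z" for z \<gamma>
    proof -
      have "?K \<gamma> z * W \<nu> \<mu> \<tau> f z = ?e (z + \<gamma>) * (?J \<gamma> z * f z)"
        using phase_twisted_factor[OF assms(2), of \<nu> \<mu> z \<gamma>] by (simp add: W mult.assoc)
      moreover have "?e (z + \<gamma>) * f (z + \<gamma>) = ?e (z + \<gamma>) * (?J \<gamma> z * f z)
          \<longleftrightarrow> f (z + \<gamma>) = ?J \<gamma> z * f z"
        by (subst mult_cancel_left) simp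
      ultimately show ?thesis
        by (simp only: W)
    qed
    moreover have "smooth (W \<nu> \<mu> \<tau> f)"
      unfolding W using assms(2) f by (rule smooth_exp_phase_mult)
    ultimately show ?thesis
      using f unfolding landau_functions_def mixed_forms_def by simp
  qed
  show ?thesis
  proof (intro equalityI subsetI)
    fix F assume "F \<in> W \<nu> \<mu> \<tau> ` mixed_forms \<Gamma> \<rho> \<tau> \<nu> \<mu>"
    then show "F \<in> landau_functions \<Gamma> (multiplier \<nu> \<mu> \<rho> \<tau>) (magnitude \<nu> \<mu> \<tau>)"
      using W_mixed_iff unfolding mixed_forms_def by blast
  next
    fix F assume F: "F \<in> landau_functions \<Gamma> (multiplier \<nu> \<mu> \<rho> \<tau>) (magnitude \<nu> \<mu> \<tau>)"
    define f where "f z = exp (- \<i> * of_real (phase \<nu> \<mu> \<tau> z)) * F z" for z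
    have "smooth f"
      unfolding f_def using F smooth_exp_phase_mult(2)[OF assms(2)]
      by (simp add: landau_functions_def)
    moreover have "W \<nu> \<mu> \<tau> f = F"
      by (rule ext) (simp add: W f_def exp_minus)
    ultimately show "F \<in> W \<nu> \<mu> \<tau> ` mixed_forms \<Gamma> \<rho> \<tau> \<nu> \<mu>"
      using F W_mixed_iff by blast
  qed
qed

end
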